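(* Let $p$ be a prime, $K$ a field with $\mathrm{char}\,K=p$, $G$ a finite $p$-group and $\mathcal{C}\leq KG$ a $G$-code. If $\mathcal{C}$ is not self-orthogonal, then $\mathcal{C}*\mathcal{C}=KG$.
   Context: $KG$ is the group algebra of $G$ over $K$. A $G$-code over $K$ is a right ideal $\mathcal{C}$ of $KG$ (written $\mathcal{C}\leq KG$). The Schur product on $KG$ is the componentwise product $\left(\sum_{g}a_g g\right)*\left(\sum_g b_g g\right)=\sum_g a_gb_g\, g$, and $\mathcal{C}*\mathcal{C}$ is the $K$-linear span of $\{c*c'\mid c,c'\in\mathcal{C}\}$. The standard inner product on $KG$ is $\langle\sum_g a_g g,\sum_g b_g g\rangle=\sum_g a_gb_g$, $\mathcal{C}^\perp=\{v\in KG\mid\langle v,c\rangle=0\text{ for all }c\in\mathcal{C}\}$, and $\mathcal{C}$ is self-orthogonal if $\mathcal{C}\subseteq\mathcal{C}^\perp$. *)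

theory Defs
  imports
    Complex_Main
    "HOL-Library.Cardinality"
    "HOL-Library.Poly_Mapping"
    "HOL-Computational_Algebra.Primes"
begin

text \<open>
  The group algebra \<open>KG\<close> is the type \<open>'g \<Rightarrow>\<^sub>0 'k\<close>, whose library multiplication is convolution
  over the operation \<open>+\<close> of \<open>'g\<close>. Hence the group is written additively, as an instance of
  \<^class>\<open>group_add\<close>; that class does not assume commutativity.
\<close>

definition right_ideal :: "'a::ring_1 set \<Rightarrow> bool" where
  "right_ideal I \<longleftrightarrow>
     0 \<in> I \<and> (\<forall>x\<in>I. \<forall>y\<in>I. x - y \<in> I) \<and> (\<forall>x\<in>I. \<forall>r. x * r \<in> I)"

type_synonym ('g, 'k) group_algebra = "'g \<Rightarrow>\<^sub>0 'k"

definition G_code :: "('g::{group_add,finite}, 'k::field) group_algebra set \<Rightarrow> bool" where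
  "G_code C \<longleftrightarrow> right_ideal C"

definition kg_scale :: "'k::field \<Rightarrow> ('g::{group_add,finite}, 'k) group_algebra \<Rightarrow> ('g, 'k) group_algebra"
  where "kg_scale a = Poly_Mapping.map ((*) a)"

lemma lookup_kg_scale [simp]: "Poly_Mapping.lookup (kg_scale a v) g = a * Poly_Mapping.lookup v g"
  by (simp add: kg_scale_def Poly_Mapping.map.rep_eq when_def)

interpretation KG: vector_space kg_scale
  by unfold_locales
    (rule poly_mapping_eqI; simp add: lookup_add algebra_simps)+

lift_definition schur_product ::
  "('g::{group_add,finite}, 'k::field) group_algebra \<Rightarrow> ('g, 'k) group_algebra \<Rightarrow> ('g, 'k) group_algebra"
  (infixl \<open>\<star>\<close> 70)
  is "\<lambda>a b g. a g * b g"
  by simp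

definition schur_square ::
  "('g::{group_add,finite}, 'k::field) group_algebra set \<Rightarrow> ('g, 'k) group_algebra set" where
  "schur_square C = KG.span {c \<star> c' | c c'. c \<in> C \<and> c' \<in> C}"

definition std_inner ::
  "('g::{group_add,finite}, 'k::field) group_algebra \<Rightarrow> ('g, 'k) group_algebra \<Rightarrow> 'k" where
  "std_inner a b = (\<Sum>g\<in>UNIV. Poly_Mapping.lookup a g * Poly_Mapping.lookup b g)"

definition dual_code ::
  "('g::{group_add,finite}, 'k::field) group_algebra set \<Rightarrow> ('g, 'k) group_algebra set" where
  "dual_code C = {v. \<forall>c\<in>C. std_inner v c = 0}"

definition self_orthogonal :: "('g::{group_add,finite}, 'k::field) group_algebra set \<Rightarrow> bool" where
  "self_orthogonal C \<longleftrightarrow> C \<subseteq> dual_code C"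

end

theory Submission
  imports Defs "HOL-Algebra.Multiplicative_Group" "HOL-Number_Theory.Cong"
begin

text \<open>
  If \<open>c, c' \<in> C\<close> are not orthogonal, then \<open>v = c \<star> c'\<close> has nonzero augmentation, and \<open>v\<close> is a unit of
  the group algebra: a nonzero \<open>x\<close> with \<open>v * x = 0\<close> would generate a finite nonzero right module over
  the group ring of the prime field, on which the \<open>p\<close>-group \<open>G\<close> fixes a nonzero element; this is a
  multiple of \<open>\<Sum>\<^sub>g g\<close>, which \<open>v\<close> does not annihilate. So left multiplication by \<open>v\<close> is injective, hence
  surjective, and \<open>C * C\<close>, being stable under right translation, contains \<open>v * KG = KG\<close>.
\<close>

section \<open>Fixed points of \<open>p\<close>-groups\<close>

text \<open>Orbit-stabilizer: \<open>T\<close> is a right action, and the fibre of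
  \<open>\<lambda>g. T g x\<close> over \<open>T h x\<close> is the stabilizer of \<open>x\<close>
  translated by \<open>h\<close> on the right. All fibres over the orbit thus have the same
  size.\<close>

lemma card_orbit_dvd:
  fixes T :: "'g::{group_add,finite} \<Rightarrow> 'a \<Rightarrow> 'a"
  assumes "\<And>g h x. T (g + h) x = T h (T g x)" and "\<And>x. T 0 x = x"
  shows "card (range (\<lambda>g. T g x)) dvd CARD('g)"
proof -
  have fibre: "card {g. T g x = T h x} = card {g. T g x = x}" for h
  proof -
    have "(\<lambda>g. g + h) ` {g. T g x = x} = {g. T g x = T h x}"
    proof (intro equalityI subsetI)
      fix g assume "g \<in> {g. T g x = T h x}"
      then have "T (g + - h) x = T (h + - h) x"
        by (simp only: assms(1) mem_Collect_eq)
      then have "T (g - h) x = x"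
        by (simp add: assms(2))
      then show "g \<in> (\<lambda>g. g + h) ` {g. T g x = x}"
        by (intro image_eqI[of _ _ "g - h"]) auto
    qed (auto simp: assms(1))
    moreover have "inj_on (\<lambda>g. g + h) {g. T g x = x}"
      by (simp add: inj_on_def)
    ultimately show ?thesis
      by (metis card_image)
  qed
  have "CARD('g) = card (\<Union>y\<in>range (\<lambda>g. T g x). {g. T g x = y})"
    by (rule arg_cong[where f = card]) auto
  also have "\<dots> = (\<Sum>y\<in>range (\<lambda>g. T g x). card {g. T g x = y})"
    by (rule card_UN_disjoint) auto
  also have "\<dots> = (\<Sum>y\<in>range (\<lambda>g. T g x). card {g. T g x = x})"
    by (rule sum.cong) (auto simp: fibre)
  finally show ?thesis
    by simp
qed

text \<open>Induction removes one nontrivial orbit at a time: its size divides \<open>p ^ n\<close>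
  and is not 1, hence is a multiple of \<open>p\<close>, and no fixed point is lost.\<close>

lemma card_fixed_points_cong:
  fixes T :: "'g::{group_add,finite} \<Rightarrow> 'a \<Rightarrow> 'a"
  assumes act: "\<And>g h x. T (g + h) x = T h (T g x)" "\<And>x. T 0 x = x"
    and p: "prime p" "CARD('g) = p ^ n"
    and "finite X" "\<And>g x. x \<in> X \<Longrightarrow> T g x \<in> X"
  shows "[card X = card {x \<in> X. \<forall>g. T g x = x}] (mod p)"
  using assms(5,6)
proof (induction X rule: finite_psubset_induct)
  case (psubset X)
  show ?case
  proof (cases "\<exists>x\<in>X. \<exists>g. T g x \<noteq> x")
    case False
    then have "{x \<in> X. \<forall>g. T g x = x} = X"
      by auto
    then show ?thesis
      by simp
  next
    case True
    then obtain x h where x: "x \<in> X" "T h x \<noteq> x"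
      by blast
    define B where "B = range (\<lambda>g. T g x)"
    have B: "x \<in> B" "T h x \<in> B" "B \<subseteq> X"
      using x psubset.prems act(2) by (auto simp: B_def intro: range_eqI[of _ _ 0])
    have "card B \<noteq> 1"
      using B x by (auto simp: card_1_singleton_iff)
    moreover have "card B dvd p ^ n"
      using card_orbit_dvd[of T x] act p(2) by (simp add: B_def)
    ultimately have "p dvd card B"
      using divides_primepow_nat[OF p(1)] by (metis dvd_power power_0 gr0I)
    \<comment> \<open>The orbit \<open>B\<close> and its complement are both stable, so that the
      induction hypothesis applies to \<open>X - B\<close>.\<close>
    have B_iff: "T g y \<in> B \<longleftrightarrow> y \<in> B" for g y
    proof
      assume "T g y \<in> B"
      then obtain k where "T g y = T k x"
        by (auto simp: B_def)
      then have "T (g + - g) y = T (k + - g) x"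
        by (simp only: act(1))
      then show "y \<in> B"
        by (auto simp: B_def act(2))
    next
      assume "y \<in> B"
      then show "T g y \<in> B"
        by (auto simp: B_def simp flip: act(1))
    qed
    \<comment> \<open>A fixed point \<open>y = T k x\<close> would be carried back to
      \<open>x\<close> by \<open>- k\<close>, forcing \<open>y = x\<close>; but \<open>h\<close>
      moves \<open>x\<close>.\<close>
    have "\<exists>g. T g y \<noteq> y" if y: "y \<in> B" for y
    proof (rule ccontr)
      assume *: "\<not> ?thesis"
      obtain k where k: "y = T k x"
        using y by (auto simp: B_def)
      have "T (k + - k) x = y"
        using * by (simp only: act(1) flip: k) blast
      then have "y = x"
        by (simp add: act(2))
      with * x show False
        by blast
    qed
    then have "{y \<in> X. \<forall>g. T g y = y} = {y \<in> X - B. \<forall>g. T g y = y}"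
      by blast
    moreover have "[card (X - B) = card {y \<in> X - B. \<forall>g. T g y = y}] (mod p)"
      using psubset.prems B x by (intro psubset.IH) (auto simp: B_iff)
    moreover have "card X = card (X - B) + card B"
      using B psubset.hyps by (metis card_Diff_subset card_mono finite_subset le_add_diff_inverse2)
    moreover have "[card (X - B) + card B = card (X - B)] (mod p)"
      using \<open>p dvd card B\<close> unfolding cong_def
      by (metis add.right_neutral dvd_imp_mod_0 mod_add_right_eq)
    ultimately show ?thesis
      by (simp add: cong_def)
  qed
qed

text \<open>Since \<open>p\<close> is zero in the ring, a nonzero \<open>w\<close> has additive
  order exactly \<open>p\<close>, and Lagrange's theorem applies to the finite additive group
  \<open>A\<close>.\<close>

lemma prime_dvd_card_additive_subgroup:
  fixes A :: "'a::ring_1 set"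
  assumes "prime p" "of_nat p = (0::'a)"
    and "finite A" "\<And>x y. x \<in> A \<Longrightarrow> y \<in> A \<Longrightarrow> x - y \<in> A"
    and "w \<in> A" "w \<noteq> 0"
  shows "p dvd card A"
proof -
  \<comment> \<open>The additive group is presented as a multiplicative \<open>monoid\<close>
    record, the form in which element orders and Lagrange's theorem are stated; powers become
    multiples \<open>of_nat k * w\<close>.\<close>
  define H where "H = (\<lparr>carrier = A, monoid.mult = (+), one = 0\<rparr> :: 'a monoid)"
  have zero: "0 \<in> A"
    using assms(4,5) by force
  have uminus: "- x \<in> A" if "x \<in> A" for x
    using assms(4)[OF zero that] by simp
  have add: "x + y \<in> A" if "x \<in> A" "y \<in> A" for x y
    using assms(4)[OF that(1) uminus[OF that(2)]] by simp
  interpret H: group H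
    by (rule groupI) (auto simp: H_def zero add add.assoc intro: uminus bexI[of _ "- _"])
  have pow: "w [^]\<^bsub>H\<^esub> k = of_nat k * w" for k :: nat
    by (induction k) (simp_all add: H_def nat_pow_def algebra_simps)
  have w: "w \<in> carrier H"
    using assms(5) by (simp add: H_def)
  have "H.ord w dvd p"
    by (simp add: assms(2) pow flip: H.pow_eq_id[OF w]) (simp add: H_def)
  moreover have "H.ord w \<noteq> 1"
    using H.ord_eq_1[OF w] assms(6) by (simp add: H_def)
  ultimately have "H.ord w = p"
    using assms(1) by (auto simp: prime_nat_iff)
  moreover have "H.ord w dvd order H"
    using w by (rule H.ord_dvd_group_order)
  ultimately show ?thesis
    by (simp add: order_def H_def)
qed

text \<open>\<open>of_int k\<close> depends only on the residue of \<open>k\<close> modulo the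
  characteristic. This gives the prime field as a finite subset of a possibly infinite
  field.\<close>

lemma finite_Ints:
  assumes "CHAR('a::ring_1) > 0"
  shows "finite (\<int> :: 'a set)"
proof (rule finite_subset)
  show "(\<int> :: 'a set) \<subseteq> of_nat ` {..<CHAR('a)}"
  proof
    fix x :: 'a assume "x \<in> \<int>"
    then obtain k where "x = of_int k"
      by (auto elim: Ints_cases)
    also have "k = k mod int CHAR('a) + int CHAR('a) * (k div int CHAR('a))"
      by simp
    also have "of_int \<dots> = (of_int (k mod int CHAR('a)) :: 'a)"
      by (simp only: of_int_add of_int_mult of_int_of_nat_eq of_nat_CHAR) simp
    also have "\<dots> = of_nat (nat (k mod int CHAR('a)))"
      using assms by (simp add: of_nat_nat)
    finally show "x \<in> of_nat ` {..<CHAR('a)}"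
      using assms by (intro image_eqI[of _ _ "nat (k mod int CHAR('a))"]) (simp_all add: nat_less_iff)
  qed
qed simp

section \<open>The group algebra\<close>

lemma lookup_times:
  fixes x y :: "('g::{group_add,finite}, 'k::field) group_algebra"
  shows "Poly_Mapping.lookup (x * y) g = (\<Sum>h\<in>UNIV. Poly_Mapping.lookup x h * Poly_Mapping.lookup y (- h + g))"
proof -
  have "g = h + q \<longleftrightarrow> q = - h + g" for h q
    by (auto simp: add.assoc[symmetric])
  then have "Poly_Mapping.lookup (x * y) g =
      Sum_any (\<lambda>h. Poly_Mapping.lookup x h * Poly_Mapping.lookup y (- h + g))"
    by (simp only: lookup_mult Sum_any_when_equal)
  also have "\<dots> = (\<Sum>h\<in>UNIV. Poly_Mapping.lookup x h * Poly_Mapping.lookup y (- h + g))"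
    by (rule Sum_any.expand_superset) auto
  finally show ?thesis .
qed

lemma lookup_times_single:
  fixes x :: "('g::{group_add,finite}, 'k::field) group_algebra"
  shows "Poly_Mapping.lookup (x * Poly_Mapping.single g a) h = Poly_Mapping.lookup x (h - g) * a"
proof -
  have "g = - l + h \<longleftrightarrow> l = h - g" for l
    by (auto simp: minus_diff_eq diff_conv_add_uminus minus_add add.assoc
        simp del: add_uminus_conv_diff)
  then show ?thesis
    by (simp add: lookup_times lookup_single mult_when) (simp add: when_def)
qed

text \<open>With scalars acting as right multiplication by ring elements, left multiplication
  commutes with them by associativity alone.\<close>

lemma kg_scale_eq_single_times: "kg_scale a v = v * Poly_Mapping.single 0 a"
  by (rule poly_mapping_eqI) (simp add: lookup_times_single mult.commute)

lemma times_right_linear: "Vector_Spaces.linear kg_scale kg_scale (\<lambda>x. v * x)"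
  by unfold_locales (simp_all add: distrib_left kg_scale_eq_single_times mult.assoc)

lemma group_algebra_eq_sum:
  fixes x :: "('g::{group_add,finite}, 'k::field) group_algebra"
  shows "x = (\<Sum>g\<in>UNIV. kg_scale (Poly_Mapping.lookup x g) (Poly_Mapping.single g 1))"
  by (rule poly_mapping_eqI) (simp add: lookup_sum lookup_single mult_when, simp add: when_def)

text \<open>The group elements form a finite basis, so an injective linear endomorphism is
  surjective by dimension.\<close>

lemma surj_times_if_inj:
  fixes v :: "('g::{group_add,finite}, 'k::field) group_algebra"
  assumes "inj (\<lambda>x. v * x)"
  shows "surj (\<lambda>x. v * x)"
proof -
  let ?B = "range (\<lambda>g. Poly_Mapping.single g 1) :: ('g, 'k) group_algebra set"
  have "KG.span ?B = UNIV"
  proof -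
    have "x \<in> KG.span ?B" for x
      by (subst group_algebra_eq_sum) (intro KG.span_sum KG.span_scale KG.span_base rangeI)
    then show ?thesis
      by blast
  qed
  moreover have "KG.independent ?B"
  proof (rule KG.independent_if_scalars_zero)
    fix f :: "('g, 'k) group_algebra \<Rightarrow> 'k" and x
    assume sum: "(\<Sum>x\<in>?B. kg_scale (f x) x) = 0" and "x \<in> ?B"
    then obtain g where x: "x = Poly_Mapping.single g 1"
      by auto
    have "inj (\<lambda>g. Poly_Mapping.single g 1 :: ('g, 'k) group_algebra)"
      by (auto simp: inj_on_def dest: arg_cong[where f = Poly_Mapping.keys])
    then have "(\<Sum>h\<in>UNIV. kg_scale (f (Poly_Mapping.single h 1)) (Poly_Mapping.single h 1)) = 0"
      using sum by (simp add: sum.reindex)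
    from arg_cong[where f = "\<lambda>x. Poly_Mapping.lookup x g", OF this] show "f x = 0"
      by (simp add: x lookup_sum lookup_single mult_when) (simp add: when_def)
  qed simp
  ultimately interpret finite_dimensional_vector_space
    "kg_scale :: 'k \<Rightarrow> ('g, 'k) group_algebra \<Rightarrow> ('g, 'k) group_algebra" ?B
    by unfold_locales auto
  show ?thesis
    using linear_inj_imp_surj[OF times_right_linear assms] .
qed

lemma times_right_eq_0_imp:
  fixes v x :: "('g::{group_add,finite}, 'k::field) group_algebra"
  assumes p: "prime CHAR('k)" "CARD('g) = CHAR('k) ^ n"
    and v: "(\<Sum>g\<in>UNIV. Poly_Mapping.lookup v g) \<noteq> 0" and "v * x = 0"
  shows "x = 0"
proof (rule ccontr)
  assume "x \<noteq> 0"
  \<comment> \<open>In prime characteristic \<open>\<int>\<close> is the prime field, so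
    \<open>F\<close> is the group ring over it and \<open>M\<close> is the right
    \<open>F\<close>-module generated by \<open>x\<close>. Both are finite even if the field is not,
    which makes counting possible.\<close>
  define F where "F = {y :: ('g, 'k) group_algebra. \<forall>g. Poly_Mapping.lookup y g \<in> \<int>}"
  define M where "M = (\<lambda>y. x * y) ` F"
  define T where "T = (\<lambda>g (m :: ('g, 'k) group_algebra). m * Poly_Mapping.single g 1)"
  have T: "T (g + h) m = T h (T g m)" "T 0 m = m" for g h m
    by (simp_all add: T_def mult.assoc mult_single)
  have single_F: "Poly_Mapping.single g 1 \<in> F" for g
    by (auto simp: F_def lookup_single when_def)
  have x: "x \<in> M"
    unfolding M_def using single_F[of 0] by (intro image_eqI[of _ _ 1]) simp_all
  have "finite (Poly_Mapping.lookup ` F)"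
  proof (rule finite_subset)
    show "Poly_Mapping.lookup ` F \<subseteq> UNIV \<rightarrow>\<^sub>E \<int>"
      by (auto simp: F_def)
    show "finite (UNIV \<rightarrow>\<^sub>E \<int> :: ('g \<Rightarrow> 'k) set)"
      using p(1) by (intro finite_PiE finite_Ints) (auto simp: prime_gt_0_nat)
  qed
  then have "finite F"
    by (rule finite_imageD) (simp add: inj_on_def lookup_inject)
  then have finite: "finite M"
    by (simp add: M_def)
  have diff: "a - b \<in> M" if "a \<in> M" "b \<in> M" for a b
    using that by (auto simp: M_def F_def lookup_minus simp flip: right_diff_distrib)
  have T_M: "T g m \<in> M" if "m \<in> M" for g m
    using that by (auto simp: M_def F_def T_def lookup_times_single mult.assoc)
  have "of_nat CHAR('k) = (0 :: ('g, 'k) group_algebra)"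
    by (simp flip: single_of_nat)
  then have "CHAR('k) dvd card M"
    using prime_dvd_card_additive_subgroup[OF p(1) _ finite diff x \<open>x \<noteq> 0\<close>] by blast
  moreover have "[card M = card {m \<in> M. \<forall>g. T g m = m}] (mod CHAR('k))"
    using T p finite T_M by (rule card_fixed_points_cong)
  ultimately have dvd: "CHAR('k) dvd card {m \<in> M. \<forall>g. T g m = m}"
    by (simp add: cong_dvd_iff)
  \<comment> \<open>The number of fixed points is a multiple of a prime, hence not 1; as 0 is fixed,
    another fixed point exists.\<close>
  have "{m \<in> M. \<forall>g. T g m = m} \<noteq> {0}"
    using dvd p(1) by auto
  moreover have "0 \<in> {m \<in> M. \<forall>g. T g m = m}"
    using diff[OF x x] by (simp add: T_def)
  ultimately obtain m where m: "m \<in> M" "\<And>g. T g m = m" "m \<noteq> 0"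
    by blast
  \<comment> \<open>Comparing coefficients of \<open>T g m = m\<close> at \<open>g\<close>
    identifies the one at \<open>g\<close> with the one at \<open>0\<close>.\<close>
  have const: "Poly_Mapping.lookup m g = Poly_Mapping.lookup m 0" for g
    using lookup_times_single[of m g 1 g] m(2)[of g] by (simp add: T_def)
  have "v * m = 0"
    using m(1) assms(4) by (auto simp: M_def simp flip: mult.assoc)
  \<comment> \<open>The coefficient of \<open>v * m\<close> at \<open>0\<close> is the augmentation
    of \<open>v\<close> times the common coefficient of \<open>m\<close>.\<close>
  then have "(\<Sum>g\<in>UNIV. Poly_Mapping.lookup v g * Poly_Mapping.lookup m (- g + 0)) = 0"
    by (simp only: lookup_zero flip: lookup_times)
  then have "(\<Sum>g\<in>UNIV. Poly_Mapping.lookup v g) * Poly_Mapping.lookup m 0 = 0"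
    by (subst (asm) const) (simp add: sum_distrib_right)
  with v have "Poly_Mapping.lookup m 0 = 0"
    by simp
  with const have "m = 0"
    by (intro poly_mapping_eqI) simp
  with m(3) show False ..
qed

text \<open>Right translation by a group element permutes the coefficients, so it distributes over
  \<open>\<star>\<close>, and it maps the right ideal \<open>C\<close> into itself. A general
  \<open>x\<close> is a linear combination of group elements.\<close>

lemma schur_product_times_in_schur_square:
  assumes "G_code C" "c \<in> C" "c' \<in> C"
  shows "(c \<star> c') * x \<in> schur_square C"
proof -
  have "(c \<star> c') * Poly_Mapping.single g 1 = (c * Poly_Mapping.single g 1) \<star> (c' * Poly_Mapping.single g 1)" for g
    by (rule poly_mapping_eqI) (simp add: lookup_times_single schur_product.rep_eq)
  moreover have "c * Poly_Mapping.single g 1 \<in> C" "c' * Poly_Mapping.single g 1 \<in> C" for g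
    using assms by (auto simp: G_code_def right_ideal_def)
  ultimately have base: "(c \<star> c') * Poly_Mapping.single g 1 \<in> schur_square C" for g
    unfolding schur_square_def by (intro KG.span_base) blast
  have "(c \<star> c') * x = (\<Sum>g\<in>UNIV. kg_scale (Poly_Mapping.lookup x g) ((c \<star> c') * Poly_Mapping.single g 1))"
    by (subst group_algebra_eq_sum[of x])
      (simp add: sum_distrib_left kg_scale_eq_single_times mult.assoc)
  also have "\<dots> \<in> schur_square C"
    using base unfolding schur_square_def by (intro KG.span_sum KG.span_scale)
  finally show ?thesis .
qed

theorem proposition3p12:
  fixes p :: nat
    and C :: "('g::{group_add,finite}, 'k::field) group_algebra set"
  assumes "prime p"
    and "CHAR('k) = p"
    and "\<exists>n. CARD('g) = p ^ n"
    and "G_code C"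
    and "\<not> self_orthogonal C"
  shows "schur_square C = UNIV"
proof -
  obtain n where n: "CARD('g) = p ^ n"
    using assms(3) ..
  obtain c c' where c: "c \<in> C" "c' \<in> C" and "std_inner c c' \<noteq> 0"
    using assms(5) by (auto simp: self_orthogonal_def dual_code_def)
  \<comment> \<open>The inner product of \<open>c\<close> and \<open>c'\<close> is the augmentation
    of \<open>c \<star> c'\<close>.\<close>
  then have "(\<Sum>g\<in>UNIV. Poly_Mapping.lookup (c \<star> c') g) \<noteq> 0"
    by (simp add: std_inner_def schur_product.rep_eq)
  then have "x = 0" if "(c \<star> c') * x = 0" for x
    using times_right_eq_0_imp that assms(1,2) n by blast
  then have "inj (\<lambda>x. (c \<star> c') * x)"
    by (intro injI) (metis eq_iff_diff_eq_0 right_diff_distrib)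
  then have "surj (\<lambda>x. (c \<star> c') * x)"
    by (rule surj_times_if_inj)
  then show ?thesis
    using schur_product_times_in_schur_square[OF assms(4) c] by (metis UNIV_eq_I surjD)
qed

end
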